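(* Let $A\in\mathbb{R}^{n\times n}$ be symmetric positive definite with at most $m_A$ nonzero entries per row, let $b\in\mathbb{R}^n$, and consider iterative refinement (as described, with its floating point model, in the context) for $Ax=b$. Let $x^{(i)}$ be the iterate at the start of the $i$th cycle and let $r=Ax^{(i)}-b$ be its residual computed in $\bar{\varepsilon}$-precision and rounded to $\varepsilon$-precision. Suppose that a $\rho<1$ exists such that, for any $r\in\mathbb{R}^n$, the solver used in the inner loop is guaranteed to compute a correction $y$ that satisfies $$\|y-A^{-1}r\|_A\le\rho\,\|A^{-1}r\|_A .$$ Then $x^{(i+1)}$ approximates the solution $A^{-1}b$ of $Ax=b$ with the relative error bound $$\frac{\|x^{(i+1)}-A^{-1}b\|_A}{\|A^{-1}b\|_A}\le\rho_{ir}\,\frac{\|x^{(i)}-A^{-1}b\|_A}{\|A^{-1}b\|_A}+\chi ,$$ where $$\rho_{ir}=\rho+\delta_{\rho_{ir}},\qquad \delta_{\rho_{ir}}=\frac{(1+2\rho)\tau+\gamma(1+\rho)(1+\varepsilon)\bar m_A^+\bar\tau}{1-\tau},$$ and $$\chi=\frac{\tau+\gamma(1+\rho)(1+\varepsilon)\bar m_A^+\bar\tau}{1-\tau}.$$ If $\rho+\delta_{\rho_{ir}}<1$, then the error after $N\ge1$ iterative refinement cycles starting with initial guess $x^{(0)}$ satisfies $$\frac{\|x^{(N)}-A^{-1}b\|_A}{\|A^{-1}b\|_A}\le(\rho+\delta_{\rho_{ir}})^N\,\frac{\|x^{(0)}-A^{-1}b\|_A}{\|A^{-1}b\|_A}+\frac{\chi}{1-(\rho+\delta_{\rho_{ir}})}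 .$$
   Context: Norms: $\|\cdot\|$ is the Euclidean vector norm and its induced matrix norm; $\|x\|_A=\|A^{1/2}x\|$ is the energy norm; $|\cdot|$ of a vector or matrix is taken entrywise and inequalities between vectors are entrywise. $\kappa(A)=\|A\|\,\|A^{-1}\|$. Precisions: $\varepsilon$ ("standard"), $\bar\varepsilon$ ("high") and $\dot\varepsilon$ ("low") are unit roundoffs with $\bar\varepsilon\le\varepsilon\le\dot\varepsilon$. The inner solver works in $\dot\varepsilon$-precision, but enters the result only through its convergence factor $\rho$. Parameters: $\psi=\|\,|A|\,\|$, $\underline{\kappa}(A)=\psi\|A^{-1}\|$, $\bar m_A^+=\dfrac{m_A+1}{1-(m_A+1)\bar\varepsilon}$, $\tau=\kappa^{1/2}(A)\,\varepsilon$, $\bar\tau=\kappa(A)\,\bar\varepsilon$, $\gamma=\dfrac{\kappa^{1/2}(A)+\underline{\kappa}(A)}{\kappa(A)}$. Iterative refinement, one cycle, with the rounding error model: given $x^{(i)}$, (1) the residual computed in $\bar\varepsilon$-precision and rounded to $\varepsilon$-precision is $r=Ax^{(i)}-b+\delta_1$ with $|\delta_1|\le\varepsilon|Ax^{(i)}-b|+(1+\varepsilon)\,\bar m_A^+\,\bar\varepsilon\,(|b|+|A|\,|x^{(i)}|)$; (2) the inner solver returns $y$, an approximation to the solution $A^{-1}r$ of $Ay=r$; (3) the update computed in $\varepsilon$-precision is $x^{(i+1)}=x^{(i)}-y+\delta_2$ with $|\delta_2|\le\varepsilon|x^{(i+1)}|$. $A$ and $b$ are assumed exact.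
   Formalization: The formal theorem also assumes τ < 1 and (m_A+1)ε̄ < 1, so that the denominators 1−τ and 1−(m_A+1)ε̄ are positive; for τ > 1 the stated first bound has a negative right-hand side and is false. *)

theory Defs
  imports "HOL-Analysis.Analysis"
begin

text \<open>
  Throughout, \<open>\<le>\<close> and \<open>\<bar>_\<bar>\<close> on vectors and matrices are the library's entrywise order and entrywise
  absolute value. The library's \<open>norm\<close> on \<open>real ^ 'n\<close> is the Euclidean norm, but on matrices it is
  the Frobenius norm; the induced matrix norm is therefore written with \<^const>\<open>onorm\<close>.
\<close>

definition spd_matrix :: "real ^ 'n ^ 'n \<Rightarrow> bool" where
  "spd_matrix A \<longleftrightarrow> transpose A = A \<and> (\<forall>x. x \<noteq> 0 \<longrightarrow> x \<bullet> (A *v x) > 0)"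

text \<open>Meaningful for symmetric positive definite \<open>A\<close> only, where the square root exists and is unique.\<close>

definition matrix_sqrt :: "real ^ 'n ^ 'n \<Rightarrow> real ^ 'n ^ 'n" where
  "matrix_sqrt A = (THE B. spd_matrix B \<and> B ** B = A)"

definition energy_norm :: "real ^ 'n ^ 'n \<Rightarrow> real ^ 'n \<Rightarrow> real" where
  "energy_norm A x = norm (matrix_sqrt A *v x)"

definition matrix_norm :: "real ^ 'n ^ 'n \<Rightarrow> real" where
  "matrix_norm A = onorm ((*v) A)"

definition cond_number :: "real ^ 'n ^ 'n \<Rightarrow> real" where
  "cond_number A = matrix_norm A * matrix_norm (matrix_inv A)"

text \<open>The quantity \<open>\<psi> \<parallel>A\<^sup>-\<^sup>1\<parallel>\<close> with \<open>\<psi> = \<parallel> |A| \<parallel>\<close>.\<close>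

definition abs_cond_number :: "real ^ 'n ^ 'n \<Rightarrow> real" where
  "abs_cond_number A = matrix_norm \<bar>A\<bar> * matrix_norm (matrix_inv A)"

definition m_plus :: "nat \<Rightarrow> real \<Rightarrow> real" where
  "m_plus m epsh = (real m + 1) / (1 - (real m + 1) * epsh)"

definition tau :: "real ^ 'n ^ 'n \<Rightarrow> real \<Rightarrow> real" where
  "tau A eps = sqrt (cond_number A) * eps"

definition tau_bar :: "real ^ 'n ^ 'n \<Rightarrow> real \<Rightarrow> real" where
  "tau_bar A epsh = cond_number A * epsh"

definition gamma_A :: "real ^ 'n ^ 'n \<Rightarrow> real" where
  "gamma_A A = (sqrt (cond_number A) + abs_cond_number A) / cond_number A"

text \<open>
  One cycle of iterative refinement for \<open>A x = b\<close> in the rounding error model, as a relation between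
  the iterates \<open>x\<close> and \<open>x'\<close> before and after the cycle. The working precision is \<open>eps\<close>, the high
  precision \<open>epsh\<close>. \<open>solver r y\<close> means that the inner solver may return \<open>y\<close> for the right-hand
  side \<open>r\<close>; a relation rather than a function, so its rounding errors need not be reproducible.
\<close>

definition ir_cycle ::
  "real ^ 'n ^ 'n \<Rightarrow> real ^ 'n \<Rightarrow> nat \<Rightarrow> real \<Rightarrow> real \<Rightarrow> (real ^ 'n \<Rightarrow> real ^ 'n \<Rightarrow> bool)
     \<Rightarrow> real ^ 'n \<Rightarrow> real ^ 'n \<Rightarrow> bool" where
  "ir_cycle A b m eps epsh solver x x' \<longleftrightarrow>
     (\<exists>r y \<delta>1 \<delta>2.
        r = A *v x - b + \<delta>1 \<and>
        \<bar>\<delta>1\<bar> \<le> eps *\<^sub>R \<bar>A *v x - b\<bar>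
                + ((1 + eps) * m_plus m epsh * epsh) *\<^sub>R (\<bar>b\<bar> + \<bar>A\<bar> *v \<bar>x\<bar>) \<and>
        solver r y \<and>
        x' = x - y + \<delta>2 \<and>
        \<bar>\<delta>2\<bar> \<le> eps *\<^sub>R \<bar>x'\<bar>)"

definition delta_rho_ir :: "real ^ 'n ^ 'n \<Rightarrow> nat \<Rightarrow> real \<Rightarrow> real \<Rightarrow> real \<Rightarrow> real" where
  "delta_rho_ir A m eps epsh \<rho> =
     ((1 + 2 * \<rho>) * tau A eps
        + gamma_A A * (1 + \<rho>) * (1 + eps) * m_plus m epsh * tau_bar A epsh) / (1 - tau A eps)"

definition chi_ir :: "real ^ 'n ^ 'n \<Rightarrow> nat \<Rightarrow> real \<Rightarrow> real \<Rightarrow> real \<Rightarrow> real" where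
  "chi_ir A m eps epsh \<rho> =
     (tau A eps
        + gamma_A A * (1 + \<rho>) * (1 + eps) * m_plus m epsh * tau_bar A epsh) / (1 - tau A eps)"

definition rel_err :: "real ^ 'n ^ 'n \<Rightarrow> real ^ 'n \<Rightarrow> real ^ 'n \<Rightarrow> real" where
  "rel_err A b x = energy_norm A (x - matrix_inv A *v b) / energy_norm A (matrix_inv A *v b)"

end

theory Submission
  imports Defs
begin

text \<open>
  The exact error recurrence of a cycle is
  \<open>e' = -A\<^sup>-\<^sup>1 \<delta>1 - \<eta> + \<delta>2\<close>, where the solver error \<open>\<eta> = y - A\<^sup>-\<^sup>1 r\<close> has energy norm at most
  \<open>\<rho> \<parallel>e + A\<^sup>-\<^sup>1 \<delta>1\<parallel>\<^sub>A\<close>. The entrywise bounds on \<open>\<delta>1\<close> and \<open>\<delta>2\<close> are turned into energy norm bounds at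
  the cost of factors \<open>\<parallel>A\<parallel>\<^sup>1\<^sup>/\<^sup>2\<close> and \<open>\<parallel>A\<^sup>-\<^sup>1\<parallel>\<^sup>1\<^sup>/\<^sup>2\<close>; since \<open>\<delta>2\<close> is bounded relative to the new iterate,
  solving for \<open>\<parallel>e'\<parallel>\<^sub>A\<close> produces the denominator \<open>1 - \<tau>\<close>. That the energy norm is well defined rests on
  the spectral theorem, which gives the existence of the square root of \<open>A\<close> and, applied to the
  difference of two square roots, its uniqueness.
\<close>

section \<open>Spectral theorem for self-adjoint maps\<close>

text \<open>The eigenvector is a maximiser of the Rayleigh quotient on the unit sphere of \<open>S\<close>.\<close>

lemma self_adjoint_eigenvector:
  fixes f :: "'a::euclidean_space \<Rightarrow> 'a"
  assumes lin: "linear f" and sa: "\<And>x y. f x \<bullet> y = x \<bullet> f y"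
    and S: "subspace S" "f ` S \<subseteq> S" "S \<noteq> {0}"
  obtains v where "v \<in> S" "norm v = 1" "f v = (v \<bullet> f v) *\<^sub>R v"
proof -
  obtain u where u: "u \<in> S" "u \<noteq> 0" using S subspace_0 by blast
  have "compact (S \<inter> sphere 0 1)"
    using closed_subspace[OF S(1)] compact_sphere by (simp add: closed_Int_compact)
  moreover have "u /\<^sub>R norm u \<in> S \<inter> sphere 0 1"
    using u S(1) by (auto simp: subspace_scale)
  moreover have "continuous_on (S \<inter> sphere 0 1) (\<lambda>x. x \<bullet> f x)"
    by (intro continuous_intros linear_continuous_on linear_conv_bounded_linear[THEN iffD1] lin)
  ultimately obtain v where v: "v \<in> S \<inter> sphere 0 1"
    and max: "\<And>x. x \<in> S \<inter> sphere 0 1 \<Longrightarrow> x \<bullet> f x \<le> v \<bullet> f v"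
    by (metis continuous_attains_sup empty_iff)
  define c where "c = v \<bullet> f v"
  have vv: "v \<bullet> v = 1" and vS: "v \<in> S" and nv: "norm v = 1"
    using v by (auto simp: norm_eq_1)
  \<comment> \<open>Both sides are homogeneous of degree two, so the maximum over the unit sphere
    controls all of \<open>S\<close>. This allows unnormalised perturbations of \<open>v\<close>
    below.\<close>
  have quad: "x \<bullet> f x \<le> c * (x \<bullet> x)" if x: "x \<in> S" for x
  proof (cases "x = 0")
    case False
    let ?y = "x /\<^sub>R norm x"
    have "?y \<bullet> f ?y \<le> c"
      unfolding c_def using False x S(1) by (intro max) (auto simp: subspace_scale)
    moreover have "?y \<bullet> f ?y = (x \<bullet> f x) / (x \<bullet> x)"
      by (simp add: linear_cmul[OF lin] dot_square_norm power2_eq_square divide_simps)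
    ultimately have "(x \<bullet> f x) / (x \<bullet> x) \<le> c" by simp
    then show ?thesis using False by (simp add: pos_divide_le_eq)
  qed (simp add: linear_0[OF lin])
  \<comment> \<open>The defect of the eigenvector equation. It is orthogonal to \<open>v\<close>, so
    moving from \<open>v\<close> in the direction \<open>w\<close> changes the squared norm only to
    second order, while the quadratic form grows at first order with slope
    \<open>2 * (w \<bullet> w)\<close>.\<close>
  define w where "w = f v - c *\<^sub>R v"
  have fvS: "f v \<in> S" using S(2) vS by auto
  have wS: "w \<in> S" unfolding w_def using S(1) vS fvS by (simp add: subspace_diff subspace_scale)
  have vw: "v \<bullet> w = 0" by (simp add: w_def inner_diff_right vv c_def)
  then have wfv: "w \<bullet> f v = w \<bullet> w"
    by (simp add: w_def inner_diff_right inner_commute)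
  define d where "d = w \<bullet> f w - c * (w \<bullet> w)"
  have ineq: "2 * t * (w \<bullet> w) + t\<^sup>2 * d \<le> 0" for t
  proof -
    let ?x = "v + t *\<^sub>R w"
    have "?x \<in> S" using S(1) vS wS by (simp add: subspace_add subspace_scale)
    then have "?x \<bullet> f ?x \<le> c * (?x \<bullet> ?x)" by (rule quad)
    moreover have "v \<bullet> f w = w \<bullet> w" using sa[of v w] wfv by (simp add: inner_commute)
    then have "?x \<bullet> f ?x = c + 2 * t * (w \<bullet> w) + t\<^sup>2 * (w \<bullet> f w)"
      using wfv by (simp add: linear_add[OF lin] linear_cmul[OF lin] inner_add_left inner_add_right
          c_def power2_eq_square algebra_simps)
    moreover have "?x \<bullet> ?x = 1 + t\<^sup>2 * (w \<bullet> w)"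
      using vw vv by (simp add: inner_add_left inner_add_right inner_commute power2_eq_square)
    ultimately have "c + 2 * t * (w \<bullet> w) + t\<^sup>2 * (w \<bullet> f w) \<le> c * (1 + t\<^sup>2 * (w \<bullet> w))"
      by (simp only:)
    then show ?thesis by (simp add: d_def algebra_simps)
  qed
  have "w \<bullet> w = 0"
  proof (rule ccontr)
    assume "w \<bullet> w \<noteq> 0"
    then have pos: "w \<bullet> w > 0" by simp
    \<comment> \<open>A step so short that the second-order term cannot outweigh the first:
      \<open>t * \<bar>d\<bar>\<close> stays below \<open>w \<bullet> w\<close>, which contradicts
      \<open>ineq\<close>.\<close>
    define t where "t = (w \<bullet> w) / (\<bar>d\<bar> + 1)"
    have t: "t > 0" "t * (\<bar>d\<bar> + 1) = w \<bullet> w" using pos by (auto simp: t_def)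
    have "t * d \<ge> - (t * \<bar>d\<bar>)" using t(1)
      by (metis abs_ge_minus_self abs_mult abs_of_pos minus_le_iff)
    moreover have "t * \<bar>d\<bar> + t = w \<bullet> w" using t(2) by (simp add: algebra_simps)
    ultimately have "2 * (w \<bullet> w) + t * d > 0" using t(1) pos by linarith
    then have "t * (2 * (w \<bullet> w) + t * d) > 0" using t(1) by simp
    then show False using ineq[of t] by (simp add: power2_eq_square algebra_simps)
  qed
  then have "f v = c *\<^sub>R v" by (simp add: w_def)
  then show thesis using that vS nv c_def by blast
qed

text \<open>Induction on the dimension: one unit eigenvector \<open>v\<close> is split off, and its
  orthogonal complement within \<open>S\<close> is again an invariant subspace, of smaller
  dimension.\<close>

lemma self_adjoint_eigenbasis:
  fixes f :: "'a::euclidean_space \<Rightarrow> 'a"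
  assumes lin: "linear f" and sa: "\<And>x y. f x \<bullet> y = x \<bullet> f y"
    and "subspace S" "f ` S \<subseteq> S"
  shows "\<exists>B. finite B \<and> B \<subseteq> S \<and> S \<subseteq> span B \<and> pairwise orthogonal B \<and>
           (\<forall>v\<in>B. norm v = 1 \<and> f v = (v \<bullet> f v) *\<^sub>R v)"
  using assms(3,4)
proof (induction "dim S" arbitrary: S rule: less_induct)
  case less
  show ?case
  proof (cases "S = {0}")
    case True
    then show ?thesis by (intro exI[of _ "{}"]) auto
  next
    case False
    then obtain v where v: "v \<in> S" "norm v = 1" "f v = (v \<bullet> f v) *\<^sub>R v"
      using self_adjoint_eigenvector[OF lin sa less.prems] by blast
    have vv: "v \<bullet> v = 1" using v(2) by (simp add: norm_eq_1)
    define T where "T = {x \<in> S. v \<bullet> x = 0}"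
    have T: "subspace T"
      using less.prems(1) by (auto simp: T_def subspace_def inner_add_right)
    \<comment> \<open>Self-adjointness moves \<open>f\<close> onto \<open>v\<close>, where it acts
      as a scalar; hence the complement is invariant.\<close>
    have "v \<bullet> f x = 0" if "x \<in> T" for x
      using sa[of v x] that by (subst (asm) v(3)) (simp add: T_def)
    then have fT: "f ` T \<subseteq> T" using less.prems(2) by (auto simp: T_def)
    have "v \<notin> T" using vv by (simp add: T_def)
    moreover have "T \<subseteq> S" by (auto simp: T_def)
    ultimately have "T \<subset> S" using v(1) by blast
    then have "dim T < dim S"
      using T less.prems(1) by (intro dim_psubset) (simp add: span_eq_iff[THEN iffD2])
    then obtain B where B: "finite B" "B \<subseteq> T" "T \<subseteq> span B" "pairwise orthogonal B"
      "\<forall>v\<in>B. norm v = 1 \<and> f v = (v \<bullet> f v) *\<^sub>R v"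
      using less.hyps[OF _ T fT] by blast
    have "S \<subseteq> span (insert v B)"
    proof
      fix x assume x: "x \<in> S"
      have "x - (v \<bullet> x) *\<^sub>R v \<in> T"
        using x v(1) vv less.prems(1)
        by (simp add: T_def subspace_diff subspace_scale inner_diff_right)
      then have "x - (v \<bullet> x) *\<^sub>R v \<in> span B" using B(3) by blast
      then show "x \<in> span (insert v B)" by (auto simp: span_insert)
    qed
    moreover have "pairwise orthogonal (insert v B)"
      using B(2,4) by (auto simp: pairwise_insert T_def orthogonal_def inner_commute)
    ultimately show ?thesis
      using B v by (intro exI[of _ "insert v B"]) (auto simp: T_def)
  qed
qed

text \<open>Spanning is replaced by the explicit expansion, so that linear maps can be evaluated
  term by term on eigenvectors.\<close>

lemma symmetric_matrix_eigenbasis: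
  fixes A :: "real ^ 'n ^ 'n"
  assumes "transpose A = A"
  shows "\<exists>B. finite B \<and> pairwise orthogonal B \<and>
           (\<forall>v\<in>B. norm v = 1 \<and> A *v v = (v \<bullet> (A *v v)) *\<^sub>R v) \<and> (\<forall>x. (\<Sum>v\<in>B. (x \<bullet> v) *\<^sub>R v) = x)"
proof -
  have sa: "(A *v x) \<bullet> y = x \<bullet> (A *v y)" for x y
    by (metis assms dot_lmul_matrix transpose_matrix_vector)
  obtain B where B: "finite B" "UNIV \<subseteq> span B" "pairwise orthogonal B"
      "\<forall>v\<in>B. norm v = 1 \<and> A *v v = (v \<bullet> (A *v v)) *\<^sub>R v"
    using self_adjoint_eigenbasis[of "(*v) A" UNIV] sa by auto
  then have "(\<Sum>v\<in>B. (x \<bullet> v) *\<^sub>R v) = x" for x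
    by (intro orthonormal_basis_expand) auto
  with B show ?thesis by blast
qed

section \<open>The square root of a positive definite matrix\<close>

lemma spd_matrix_inner_commute: "spd_matrix A \<Longrightarrow> (A *v x) \<bullet> y = x \<bullet> (A *v y)"
  by (metis dot_lmul_matrix spd_matrix_def transpose_matrix_vector)

text \<open>In an orthonormal eigenbasis \<open>A\<close> is diagonal with positive entries, and the
  root is obtained by taking the square root of each entry.\<close>

lemma spd_matrix_sqrt_exists:
  fixes A :: "real ^ 'n ^ 'n"
  assumes spd: "spd_matrix A"
  shows "\<exists>R. spd_matrix R \<and> R ** R = A"
proof -
  have sym: "transpose A = A" using spd by (simp add: spd_matrix_def)
  obtain B where B: "finite B" "pairwise orthogonal B" "\<And>v. v \<in> B \<Longrightarrow> norm v = 1"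
    and eig: "\<And>v. v \<in> B \<Longrightarrow> A *v v = (v \<bullet> (A *v v)) *\<^sub>R v"
    and expand: "\<And>x. (\<Sum>v\<in>B. (x \<bullet> v) *\<^sub>R v) = x"
    using symmetric_matrix_eigenbasis[OF sym] by meson
  define l where "l v = v \<bullet> (A *v v)" for v
  have l: "l v > 0" if "v \<in> B" for v
    using B(3)[OF that] spd unfolding l_def spd_matrix_def by (metis norm_zero zero_neq_one)
  define g where "g x = (\<Sum>v\<in>B. (sqrt (l v) * (x \<bullet> v)) *\<^sub>R v)" for x
  have lin: "linear g"
    by (rule linearI) (simp_all add: g_def inner_add_left algebra_simps sum.distrib scaleR_sum_right)
  \<comment> \<open>This bilinear form is visibly symmetric in \<open>x\<close> and
    \<open>y\<close>, and for \<open>x = y\<close> it is a sum of nonnegative terms; symmetry and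
    definiteness of the root are both read off from it.\<close>
  have ginner: "g x \<bullet> y = (\<Sum>v\<in>B. sqrt (l v) * (x \<bullet> v) * (y \<bullet> v))" for x y
    unfolding g_def inner_sum_left by (simp add: inner_commute)
  have gv: "g x \<bullet> v = sqrt (l v) * (x \<bullet> v)" if "v \<in> B" for x v
  proof -
    have "g x \<bullet> v = (\<Sum>w\<in>B. if w = v then sqrt (l v) * (x \<bullet> v) else 0)"
      unfolding g_def inner_sum_left
      using B(2,3) that
      by (intro sum.cong) (auto simp: pairwise_def orthogonal_def norm_eq_1)
    then show ?thesis using B(1) that by simp
  qed
  have gg: "g (g x) = A *v x" for x
  proof -
    have "g (g x) = (\<Sum>v\<in>B. (x \<bullet> v) *\<^sub>R (l v *\<^sub>R v))"
      unfolding g_def[of "g x"] using l by (intro sum.cong) (auto simp: gv less_imp_le)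
    also have "\<dots> = (\<Sum>v\<in>B. (x \<bullet> v) *\<^sub>R (A *v v))"
      using eig by (intro sum.cong) (auto simp: l_def)
    also have "\<dots> = A *v (\<Sum>v\<in>B. (x \<bullet> v) *\<^sub>R v)"
      by (simp add: matrix_vector_mult_scaleR linear_sum[OF matrix_vector_mul_linear])
    finally show ?thesis by (simp add: expand)
  qed
  have mg: "matrix g *v x = g x" for x using lin by (simp add: matrix_works)
  have "x \<bullet> (matrix g *v x) > 0" if "x \<noteq> 0" for x
  proof -
    have "x \<bullet> (matrix g *v x) = (\<Sum>v\<in>B. sqrt (l v) * (x \<bullet> v)\<^sup>2)"
      using ginner[of x x] by (simp add: mg inner_commute power2_eq_square mult.assoc)
    moreover have "(\<Sum>v\<in>B. (x \<bullet> v) *\<^sub>R v) \<noteq> 0"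
      using expand[of x] that by simp
    then obtain v where "v \<in> B" "(x \<bullet> v) *\<^sub>R v \<noteq> 0"
      by (rule sum.not_neutral_contains_not_neutral)
    then have "(\<Sum>v\<in>B. sqrt (l v) * (x \<bullet> v)\<^sup>2) > 0"
      using B(1) l by (intro sum_pos2[of _ v]) (auto simp: less_imp_le)
    ultimately show ?thesis by simp
  qed
  moreover have "transpose (matrix g) = matrix g"
  proof -
    have "transpose (matrix g) *v x = matrix g *v x" for x
    proof (rule vector_eq_rdot[THEN iffD1, rule_format])
      fix y
      have "(transpose (matrix g) *v x) \<bullet> y = x \<bullet> g y"
        by (metis dot_lmul_matrix mg transpose_matrix_vector)
      also have "\<dots> = g x \<bullet> y"
        unfolding inner_commute[of x "g y"] ginner by (simp add: ac_simps)
      finally show "(transpose (matrix g) *v x) \<bullet> y = (matrix g *v x) \<bullet> y" by (simp add: mg)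
    qed
    then show ?thesis by (simp add: matrix_eq)
  qed
  moreover have "matrix g ** matrix g = A"
    by (simp add: matrix_eq matrix_vector_mul_assoc[symmetric] mg gg)
  ultimately show ?thesis by (auto simp: spd_matrix_def)
qed

text \<open>Commutation of \<open>P\<close> and \<open>Q\<close> is not assumed, so the argument
  diagonalises the symmetric matrix \<open>P - Q\<close> and shows that each of its eigenvalues
  vanishes.\<close>

lemma spd_matrix_sqrt_unique:
  fixes P Q :: "real ^ 'n ^ 'n"
  assumes P: "spd_matrix P" and Q: "spd_matrix Q" and eq: "P ** P = Q ** Q"
  shows "P = Q"
proof -
  have "transpose (P - Q) = transpose P - transpose Q"
    by (simp add: transpose_def vec_eq_iff)
  then have sym: "transpose (P - Q) = P - Q"
    using P Q by (simp add: spd_matrix_def)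
  obtain B where B: "\<And>v. v \<in> B \<Longrightarrow> norm v = 1"
    and eig: "\<And>v. v \<in> B \<Longrightarrow> (P - Q) *v v = (v \<bullet> ((P - Q) *v v)) *\<^sub>R v"
    and expand: "\<And>x. (\<Sum>v\<in>B. (x \<bullet> v) *\<^sub>R v) = x"
    using symmetric_matrix_eigenbasis[OF sym] by meson
  have ker: "(P - Q) *v v = 0" if v: "v \<in> B" for v
  proof -
    define c where "c = v \<bullet> ((P - Q) *v v)"
    have c: "P *v v - Q *v v = c *\<^sub>R v"
      using eig[OF v] by (simp add: c_def matrix_vector_mult_diff_rdistrib)
    have "P *v (P *v v) = Q *v (Q *v v)"
      using eq by (simp add: matrix_vector_mul_assoc)
    \<comment> \<open>The expression equals
      \<open>v \<bullet> (P *v (P *v v)) - v \<bullet> (Q *v (Q *v v))\<close>, because the mixed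
      terms cancel by self-adjointness. Inserting the eigenvalue \<open>c\<close> of
      \<open>P - Q\<close> makes it \<open>c\<close> times a positive number.\<close>
    then have "0 = v \<bullet> (P *v (P *v v - Q *v v)) + (P *v v - Q *v v) \<bullet> (Q *v v)"
      using spd_matrix_inner_commute[OF P, of v "Q *v v"] spd_matrix_inner_commute[OF Q, of v "Q *v v"]
      by (simp add: matrix_vector_mult_diff_distrib inner_diff_right inner_diff_left)
    also have "\<dots> = c * (v \<bullet> (P *v v) + v \<bullet> (Q *v v))"
      by (simp add: c matrix_vector_mult_scaleR algebra_simps)
    finally have "c = 0 \<or> v \<bullet> (P *v v) + v \<bullet> (Q *v v) = 0" by simp
    moreover have "v \<noteq> 0" using B[OF v] by auto
    then have "v \<bullet> (P *v v) > 0" "v \<bullet> (Q *v v) > 0" using P Q by (auto simp: spd_matrix_def)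
    ultimately show ?thesis using eig[OF v] by (simp add: c_def)
  qed
  have "(P - Q) *v x = 0" for x
  proof -
    have "(P - Q) *v x = (\<Sum>v\<in>B. (x \<bullet> v) *\<^sub>R ((P - Q) *v v))"
      by (subst expand[of x, symmetric])
        (simp add: matrix_vector_mult_scaleR linear_sum[OF matrix_vector_mul_linear])
    then show ?thesis by (simp add: ker)
  qed
  then show ?thesis by (simp add: matrix_eq matrix_vector_mult_diff_rdistrib)
qed

text \<open>Existence and uniqueness together make the definite description in
  \<open>matrix_sqrt\<close> denote.\<close>

lemma matrix_sqrt:
  assumes "spd_matrix A"
  shows "spd_matrix (matrix_sqrt A)" "matrix_sqrt A ** matrix_sqrt A = A"
proof -
  have "\<exists>!R. spd_matrix R \<and> R ** R = A"
    using spd_matrix_sqrt_exists[OF assms] spd_matrix_sqrt_unique by metis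
  from theI'[OF this] show "spd_matrix (matrix_sqrt A)" "matrix_sqrt A ** matrix_sqrt A = A"
    by (simp_all add: matrix_sqrt_def)
qed

section \<open>Norm estimates\<close>

lemma matrix_norm_bound:
  fixes A :: "real ^ 'n ^ 'n"
  shows "norm (A *v x) \<le> matrix_norm A * norm x"
  unfolding matrix_norm_def by (rule onorm[OF matrix_vector_mul_bounded_linear])

lemma matrix_norm_nonneg: "0 \<le> matrix_norm (A :: real ^ 'n ^ 'n)"
  unfolding matrix_norm_def by (rule onorm_pos_le[OF matrix_vector_mul_bounded_linear])

lemma norm_mono_entrywise: "norm x \<le> norm y" if "\<bar>x\<bar> \<le> y" for x y :: "real ^ 'n"
proof (rule norm_le_componentwise_cart)
  show "norm (x $ i) \<le> norm (y $ i)" for i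
    using that by (simp add: less_eq_vec_def abs_vec_def) (meson abs_ge_self order_trans)
qed

lemma norm_abs_vec: "norm \<bar>x\<bar> = norm x" for x :: "real ^ 'n"
  by (intro antisym norm_le_componentwise_cart) (simp_all add: abs_vec_def)

lemma energy_norm_nonneg: "0 \<le> energy_norm A x"
  by (simp add: energy_norm_def)

lemma energy_norm_triangle: "energy_norm A (x + y) \<le> energy_norm A x + energy_norm A y"
  by (simp add: energy_norm_def matrix_vector_right_distrib norm_triangle_ineq)

lemma energy_norm_minus: "energy_norm A (- x) = energy_norm A x"
  using matrix_vector_mult_diff_distrib[of "matrix_sqrt A" 0 x]
  by (simp add: energy_norm_def)

section \<open>Energy norm against Euclidean norm, and rounding errors in the energy norm\<close>

context
  fixes A :: "real ^ 'n ^ 'n"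
  assumes spd: "spd_matrix A"
begin

lemma energy_inner: "(matrix_sqrt A *v x) \<bullet> (matrix_sqrt A *v y) = x \<bullet> (A *v y)"
  using matrix_sqrt[OF spd] spd_matrix_inner_commute[of "matrix_sqrt A" x "matrix_sqrt A *v y"]
  by (simp add: matrix_vector_mul_assoc)

lemma energy_norm_sq: "(energy_norm A x)\<^sup>2 = x \<bullet> (A *v x)"
  by (simp add: energy_norm_def energy_inner[symmetric] power2_norm_eq_inner)

lemma energy_norm_pos: "x \<noteq> 0 \<Longrightarrow> 0 < energy_norm A x"
  using energy_norm_sq[of x] energy_norm_nonneg[of A x] spd
  by (metis less_eq_real_def order_less_irrefl power_zero_numeral spd_matrix_def)

lemma spd_inverse: "A *v (matrix_inv A *v x) = x" "matrix_inv A *v (A *v x) = x"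
proof -
  have "x = 0" if "A *v x = 0" for x
    using spd that by (metis inner_zero_right order_less_irrefl spd_matrix_def)
  then have "invertible A"
    by (simp add: invertible_left_inverse matrix_left_invertible_ker)
  then have "A ** matrix_inv A = mat 1" "matrix_inv A ** A = mat 1"
    unfolding invertible_def matrix_inv_def by (metis (mono_tags, lifting) someI_ex)+
  then show "A *v (matrix_inv A *v x) = x" "matrix_inv A *v (A *v x) = x"
    by (simp_all add: matrix_vector_mul_assoc)
qed

lemma energy_norm_le_norm: "energy_norm A x \<le> sqrt (matrix_norm A) * norm x"
proof (rule power2_le_imp_le)
  have "x \<bullet> (A *v x) \<le> norm x * norm (A *v x)" by (rule norm_cauchy_schwarz)
  also have "\<dots> \<le> norm x * (matrix_norm A * norm x)"
    by (intro mult_left_mono matrix_norm_bound) simp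
  finally show "(energy_norm A x)\<^sup>2 \<le> (sqrt (matrix_norm A) * norm x)\<^sup>2"
    using matrix_norm_nonneg[of A]
    by (simp add: energy_norm_sq power_mult_distrib) (simp add: power2_eq_square ac_simps)
qed (simp add: matrix_norm_nonneg)

text \<open>The preceding bound at the vector \<open>matrix_sqrt A *v x\<close>: its energy norm is
  \<open>norm (A *v x)\<close> and its Euclidean norm is \<open>energy_norm A x\<close>.\<close>

lemma norm_mult_le_energy_norm: "norm (A *v x) \<le> sqrt (matrix_norm A) * energy_norm A x"
  using energy_norm_le_norm[of "matrix_sqrt A *v x"]
  by (simp add: energy_norm_def matrix_vector_mul_assoc matrix_sqrt(2)[OF spd])

lemma energy_norm_inverse_le_norm:
  "energy_norm A (matrix_inv A *v z) \<le> sqrt (matrix_norm (matrix_inv A)) * norm z"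
proof (rule power2_le_imp_le)
  have "(matrix_inv A *v z) \<bullet> z \<le> norm (matrix_inv A *v z) * norm z" by (rule norm_cauchy_schwarz)
  also have "\<dots> \<le> matrix_norm (matrix_inv A) * norm z * norm z"
    by (intro mult_right_mono matrix_norm_bound) simp
  finally show "(energy_norm A (matrix_inv A *v z))\<^sup>2
      \<le> (sqrt (matrix_norm (matrix_inv A)) * norm z)\<^sup>2"
    using matrix_norm_nonneg[of "matrix_inv A"]
    by (simp add: energy_norm_sq spd_inverse power_mult_distrib)
      (simp add: power2_eq_square ac_simps)
qed (simp add: matrix_norm_nonneg)

text \<open>Duality: \<open>x \<bullet> x\<close> is the energy inner product of \<open>x\<close>
  with \<open>matrix_inv A *v x\<close>. Cauchy-Schwarz and the previous lemma then leave one factor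
  \<open>norm x\<close> to cancel, which is why zero is treated apart.\<close>

lemma norm_le_energy_norm: "norm x \<le> sqrt (matrix_norm (matrix_inv A)) * energy_norm A x"
proof (cases "x = 0")
  case False
  let ?B = "matrix_sqrt A"
  have "norm x * norm x = (?B *v x) \<bullet> (?B *v (matrix_inv A *v x))"
    by (simp add: energy_inner spd_inverse dot_square_norm power2_eq_square)
  also have "\<dots> \<le> energy_norm A x * energy_norm A (matrix_inv A *v x)"
    unfolding energy_norm_def by (rule norm_cauchy_schwarz)
  also have "\<dots> \<le> energy_norm A x * (sqrt (matrix_norm (matrix_inv A)) * norm x)"
    by (intro mult_left_mono energy_norm_inverse_le_norm energy_norm_nonneg)
  finally show ?thesis using False by (simp add: ac_simps)
qed (simp add: energy_norm_nonneg matrix_norm_nonneg)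

text \<open>Since \<open>A\<close> times its inverse fixes a unit vector, the product of the two
  norms is at least one. Positivity is what later allows the denominator of \<open>gamma_A\<close>
  to be cancelled.\<close>

lemma cond_number_pos: "0 < cond_number A"
proof -
  obtain x :: "real ^ 'n" where x: "norm x = 1" using vector_choose_size[of 1] by auto
  have "norm x \<le> matrix_norm A * norm (matrix_inv A *v x)"
    using matrix_norm_bound[of A "matrix_inv A *v x"] by (simp add: spd_inverse)
  also have "\<dots> \<le> matrix_norm A * (matrix_norm (matrix_inv A) * norm x)"
    by (intro mult_left_mono matrix_norm_bound matrix_norm_nonneg)
  finally show ?thesis using x by (simp add: cond_number_def)
qed

text \<open>Passing from the energy norm to the Euclidean norm and back costs
  \<open>sqrt (matrix_norm A)\<close> and \<open>sqrt (matrix_norm (matrix_inv A))\<close>, whose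
  product with \<open>eps\<close> is \<open>tau A eps\<close>.\<close>

lemma update_rounding_bound:
  assumes "0 \<le> eps" "\<bar>d\<bar> \<le> eps *\<^sub>R \<bar>x\<bar>"
  shows "energy_norm A d \<le> tau A eps * energy_norm A x"
proof -
  have "energy_norm A d \<le> sqrt (matrix_norm A) * norm d" by (rule energy_norm_le_norm)
  also have "\<dots> \<le> sqrt (matrix_norm A) * (eps * norm x)"
    using norm_mono_entrywise[OF assms(2)] assms(1)
    by (intro mult_left_mono) (simp_all add: norm_abs_vec matrix_norm_nonneg)
  also have "\<dots> \<le> sqrt (matrix_norm A) * (eps * (sqrt (matrix_norm (matrix_inv A)) * energy_norm A x))"
    using assms(1) by (intro mult_left_mono norm_le_energy_norm) (simp_all add: matrix_norm_nonneg)
  finally show ?thesis by (simp add: tau_def cond_number_def real_sqrt_mult ac_simps)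
qed

text \<open>Applying the inverse costs one factor \<open>q\<close>. Combined with the factor
  \<open>p\<close> from the residual and from \<open>b\<close> it gives the root of the condition
  number; combined with the \<open>q\<close> from \<open>norm x\<close> it gives the inverse norm
  inside \<open>abs_cond_number\<close>.\<close>

lemma residual_rounding_bound:
  fixes x b d :: "real ^ 'n"
  assumes "0 \<le> eps" "0 \<le> c"
    and d: "\<bar>d\<bar> \<le> eps *\<^sub>R \<bar>A *v x - b\<bar> + c *\<^sub>R (\<bar>b\<bar> + \<bar>A\<bar> *v \<bar>x\<bar>)"
  defines "s \<equiv> matrix_inv A *v b"
  shows "energy_norm A (matrix_inv A *v d) \<le> tau A eps * energy_norm A (x - s)
    + c * (sqrt (cond_number A) + abs_cond_number A) * (energy_norm A s + energy_norm A (x - s))"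
proof -
  define p q where "p = sqrt (matrix_norm A)" and "q = sqrt (matrix_norm (matrix_inv A))"
  define e E where "e = energy_norm A (x - s)" and "E = energy_norm A s"
  have nonneg: "0 \<le> p" "0 \<le> q" "0 \<le> e" "0 \<le> E" "0 \<le> matrix_norm \<bar>A\<bar>"
    by (simp_all add: p_def q_def e_def E_def matrix_norm_nonneg energy_norm_nonneg)
  have qq: "q * q = matrix_norm (matrix_inv A)" and pq: "p * q = sqrt (cond_number A)"
    by (simp_all add: p_def q_def cond_number_def real_sqrt_mult matrix_norm_nonneg)
  have "norm (A *v x - b) = norm (A *v (x - s))"
    by (simp add: s_def matrix_vector_mult_diff_distrib spd_inverse)
  then have 1: "norm (A *v x - b) \<le> p * e"
    using norm_mult_le_energy_norm[of "x - s"] by (simp add: p_def e_def)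
  have 2: "norm b \<le> p * E"
    using norm_mult_le_energy_norm[of s] by (simp add: p_def E_def s_def spd_inverse)
  have "energy_norm A x \<le> E + e"
    using energy_norm_triangle[of A s "x - s"] by (simp add: e_def E_def)
  then have "norm x \<le> q * (E + e)"
    using norm_le_energy_norm[of x] nonneg(2) by (metis mult_left_mono order_trans q_def)
  then have 3: "norm (\<bar>A\<bar> *v \<bar>x\<bar>) \<le> matrix_norm \<bar>A\<bar> * (q * (E + e))"
    using matrix_norm_bound[of "\<bar>A\<bar>" "\<bar>x\<bar>"] nonneg(5)
    by (metis mult_left_mono norm_abs_vec order_trans)
  have "norm d \<le> norm (eps *\<^sub>R \<bar>A *v x - b\<bar> + c *\<^sub>R (\<bar>b\<bar> + \<bar>A\<bar> *v \<bar>x\<bar>))"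
    by (rule norm_mono_entrywise[OF d])
  also have "\<dots> \<le> norm (eps *\<^sub>R \<bar>A *v x - b\<bar>) + norm (c *\<^sub>R (\<bar>b\<bar> + \<bar>A\<bar> *v \<bar>x\<bar>))"
    by (rule norm_triangle_ineq)
  also have "\<dots> \<le> eps * norm (A *v x - b) + c * (norm b + norm (\<bar>A\<bar> *v \<bar>x\<bar>))"
    using assms(1,2) norm_triangle_ineq[of "\<bar>b\<bar>" "\<bar>A\<bar> *v \<bar>x\<bar>"]
    by (simp add: norm_abs_vec mult_left_mono)
  also have "\<dots> \<le> eps * (p * e) + c * (p * E + matrix_norm \<bar>A\<bar> * (q * (E + e)))"
    using 1 2 3 assms(1,2) by (intro add_mono mult_left_mono) auto
  \<comment> \<open>The contribution of \<open>b\<close> is deliberately enlarged from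
    \<open>E\<close> to \<open>E + e\<close>, so that it shares a factor with that of
    \<open>x\<close> and both merge into the single coefficient behind
    \<open>gamma_A\<close>.\<close>
  also have "\<dots> \<le> eps * (p * e) + c * (p * (E + e) + matrix_norm \<bar>A\<bar> * (q * (E + e)))"
    using nonneg assms(2) by (intro add_mono mult_left_mono order_refl) auto
  finally have "q * norm d
      \<le> q * (eps * (p * e) + c * (p * (E + e) + matrix_norm \<bar>A\<bar> * (q * (E + e))))"
    using nonneg(2) by (rule mult_left_mono)
  also have "\<dots> = (p * q) * eps * e + c * (p * q + matrix_norm \<bar>A\<bar> * (q * q)) * (E + e)"
    by (simp add: algebra_simps)
  finally show ?thesis
    using energy_norm_inverse_le_norm[of d]
    by (simp add: qq pq q_def[symmetric] e_def E_def tau_def abs_cond_number_def)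
qed

end

section \<open>Error bounds for iterative refinement\<close>

text \<open>The number \<open>c / (1 - q)\<close> is the fixed point of the map sending
  \<open>t\<close> to \<open>q * t + c\<close>, so each step reproduces it and multiplies the
  remaining term by \<open>q\<close>.\<close>

lemma affine_recursion_bound:
  fixes a :: "nat \<Rightarrow> real"
  assumes "0 \<le> q" "q < 1" "0 \<le> c"
    and step: "\<And>i. i < N \<Longrightarrow> a (Suc i) \<le> q * a i + c"
  shows "a N \<le> q ^ N * a 0 + c / (1 - q)"
  using step
proof (induction N)
  case (Suc N)
  have "a (Suc N) \<le> q * a N + c" using Suc.prems by simp
  also have "\<dots> \<le> q * (q ^ N * a 0 + c / (1 - q)) + c"
    using Suc assms(1) by (intro add_right_mono mult_left_mono) auto
  also have "\<dots> = q ^ Suc N * a 0 + c / (1 - q)"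
    using assms(2) by (simp add: field_simps)
  finally show ?case .
\<comment> \<open>For \<open>N = 0\<close> the claim only says that the fixed point is
  nonnegative.\<close>
qed (use assms in simp)

text \<open>The one-cycle bound before division by the energy norm of the solution, hence meaningful
  for \<open>b = 0\<close> as well.\<close>

lemma ir_cycle_energy_bound:
  fixes A :: "real ^ 'n ^ 'n"
  assumes spd: "spd_matrix A" and eps: "0 \<le> eps" and epsh: "0 \<le> epsh"
    and m: "(real m + 1) * epsh < 1" and tau: "tau A eps < 1" and rho: "0 \<le> \<rho>"
    and solver: "\<And>r y. solver r y \<Longrightarrow>
           energy_norm A (y - matrix_inv A *v r) \<le> \<rho> * energy_norm A (matrix_inv A *v r)"
    and cycle: "ir_cycle A b m eps epsh solver x x'"
  defines "s \<equiv> matrix_inv A *v b"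
  shows "energy_norm A (x' - s)
    \<le> (\<rho> + delta_rho_ir A m eps epsh \<rho>) * energy_norm A (x - s)
      + chi_ir A m eps epsh \<rho> * energy_norm A s"
proof -
  obtain r y d1 d2 where r: "r = A *v x - b + d1"
    and d1: "\<bar>d1\<bar> \<le> eps *\<^sub>R \<bar>A *v x - b\<bar>
                + ((1 + eps) * m_plus m epsh * epsh) *\<^sub>R (\<bar>b\<bar> + \<bar>A\<bar> *v \<bar>x\<bar>)"
    and y: "solver r y" and x': "x' = x - y + d2" and d2: "\<bar>d2\<bar> \<le> eps *\<^sub>R \<bar>x'\<bar>"
    using cycle unfolding ir_cycle_def by blast
  define c where "c = (1 + eps) * m_plus m epsh * epsh"
  have c: "0 \<le> c" using eps epsh m by (simp add: c_def m_plus_def)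
  define g where "g = c * (sqrt (cond_number A) + abs_cond_number A)"
  define t where "t = tau A eps"
  define e e' E where "e = energy_norm A (x - s)" and "e' = energy_norm A (x' - s)"
    and "E = energy_norm A s"
  define u where "u = matrix_inv A *v d1"
  define n where "n = y - matrix_inv A *v r"
  \<comment> \<open>The correction requested from the solver is the current error plus the
    propagated residual rounding \<open>u\<close>; subtracting it removes the current error and
    leaves only \<open>u\<close>, the solver error \<open>n\<close> and \<open>d2\<close>.\<close>
  have inv_r: "matrix_inv A *v r = (x - s) + u"
    by (simp add: r s_def u_def matrix_vector_right_distrib matrix_vector_mult_diff_distrib
        spd_inverse[OF spd])
  have t: "0 \<le> t" "t < 1"
    using eps tau cond_number_pos[OF spd] by (simp_all add: t_def tau_def)
  have u: "energy_norm A u \<le> t * e + g * (E + e)"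
    using residual_rounding_bound[OF spd eps c d1[folded c_def]]
    by (simp add: u_def t_def e_def E_def g_def s_def)
  have "energy_norm A n \<le> \<rho> * energy_norm A ((x - s) + u)"
    using solver[OF y] by (simp add: n_def inv_r)
  also have "\<dots> \<le> \<rho> * (e + energy_norm A u)"
    using rho energy_norm_triangle[of A "x - s" u] by (simp add: e_def mult_left_mono)
  finally have n: "energy_norm A n \<le> \<rho> * (e + energy_norm A u)" .
  have "energy_norm A d2 \<le> t * energy_norm A x'"
    unfolding t_def by (rule update_rounding_bound[OF spd eps d2])
  also have "\<dots> \<le> t * (e' + E)"
    using t(1) energy_norm_triangle[of A "x' - s" s] by (simp add: e'_def E_def mult_left_mono)
  finally have d2': "energy_norm A d2 \<le> t * (e' + E)" .
  have "x' - s = (- u + - n) + d2" by (simp add: x' n_def inv_r)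
  then have "e' \<le> energy_norm A u + energy_norm A n + energy_norm A d2"
    using energy_norm_triangle[of A "- u + - n" d2] energy_norm_triangle[of A "- u" "- n"]
    by (simp add: e'_def energy_norm_minus)
  also have "\<dots> \<le> (1 + \<rho>) * energy_norm A u + \<rho> * e + t * (e' + E)"
    using n d2' by (simp add: algebra_simps)
  also have "\<dots> \<le> (1 + \<rho>) * (t * e + g * (E + e)) + \<rho> * e + t * (e' + E)"
    using u rho by (intro add_right_mono mult_left_mono) auto
  \<comment> \<open>The new error also occurs on the right, through the update rounding relative to
    \<open>x'\<close>; moving it to the left gives the factor \<open>1 - t\<close>.\<close>
  finally have "(1 - t) * e' \<le> (\<rho> + (1 + \<rho>) * t + (1 + \<rho>) * g) * e + (t + (1 + \<rho>) * g) * E"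
    by (simp add: algebra_simps)
  then have "e' \<le> ((\<rho> + (1 + \<rho>) * t + (1 + \<rho>) * g) * e + (t + (1 + \<rho>) * g) * E) / (1 - t)"
    using t(2) by (simp add: pos_le_divide_eq mult.commute)
  \<comment> \<open>The doubled \<open>\<rho>\<close> comes from isolating the solver's own factor:
    \<open>\<rho> + (1 + \<rho>) * t = \<rho> * (1 - t) + (1 + 2 * \<rho>) * t\<close>.\<close>
  also have "\<dots> = (\<rho> + ((1 + 2 * \<rho>) * t + (1 + \<rho>) * g) / (1 - t)) * e
      + (t + (1 + \<rho>) * g) / (1 - t) * E"
    using t(2) by (simp add: divide_simps) (simp add: algebra_simps)
  \<comment> \<open>The condition number in \<open>tau_bar\<close> cancels the denominator of
    \<open>gamma_A\<close>.\<close>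
  also have "(1 + \<rho>) * g
      = gamma_A A * (1 + \<rho>) * (1 + eps) * m_plus m epsh * tau_bar A epsh"
    using cond_number_pos[OF spd] by (simp add: g_def c_def gamma_A_def tau_bar_def)
  finally show ?thesis
    by (simp add: e'_def e_def E_def t_def delta_rho_ir_def chi_ir_def)
qed

text \<open>The sign of \<open>\<rho>\<close> follows from a right-hand side \<open>A *v z\<close>
  with \<open>z\<close> nonzero: the solver returns some answer, and its error, which is
  nonnegative, is bounded by \<open>\<rho>\<close> times a positive number.\<close>

lemma convergence_factor_nonneg:
  fixes A :: "real ^ 'n ^ 'n"
  assumes spd: "spd_matrix A" and total: "\<forall>r. \<exists>y. solver r y"
    and solver: "\<And>r y. solver r y \<Longrightarrow>
           energy_norm A (y - matrix_inv A *v r) \<le> \<rho> * energy_norm A (matrix_inv A *v r)"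
  shows "0 \<le> \<rho>"
proof -
  obtain z :: "real ^ 'n" where z: "norm z = 1" using vector_choose_size[of 1] by auto
  obtain y where "solver (A *v z) y" using total by blast
  then have "0 \<le> \<rho> * energy_norm A z"
    using solver energy_norm_nonneg order_trans by (metis spd_inverse(2)[OF spd])
  moreover have "0 < energy_norm A z" using z by (intro energy_norm_pos[OF spd]) auto
  ultimately show ?thesis by (simp add: zero_le_mult_iff)
qed

text \<open>These signs are required to iterate the one-cycle bound, and that of
  \<open>chi_ir\<close> also settles the case where the exact solution has zero energy norm.\<close>

lemma ir_constants_nonneg:
  fixes A :: "real ^ 'n ^ 'n"
  assumes spd: "spd_matrix A" and "0 \<le> eps" "0 \<le> epsh" "(real m + 1) * epsh < 1"
    "tau A eps < 1" "0 \<le> \<rho>"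
  shows "0 \<le> delta_rho_ir A m eps epsh \<rho>" "0 \<le> chi_ir A m eps epsh \<rho>"
proof -
  have "0 \<le> tau A eps" "0 \<le> tau_bar A epsh" "0 \<le> gamma_A A" "0 \<le> m_plus m epsh"
    using assms(2-4) cond_number_pos[OF spd]
    by (simp_all add: tau_def tau_bar_def gamma_A_def m_plus_def abs_cond_number_def matrix_norm_nonneg)
  then show "0 \<le> delta_rho_ir A m eps epsh \<rho>" "0 \<le> chi_ir A m eps epsh \<rho>"
    using assms by (simp_all add: delta_rho_ir_def chi_ir_def)
qed

theorem theorem4p1:
  fixes A :: "real ^ 'n ^ 'n" and b :: "real ^ 'n" and m :: nat
    and eps epsh epsl \<rho> :: real
    and solver :: "real ^ 'n \<Rightarrow> real ^ 'n \<Rightarrow> bool"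
  assumes spd: "spd_matrix A"
    and sparse: "\<forall>i. card {j. A $ i $ j \<noteq> 0} \<le> m"
    and precisions: "0 \<le> epsh" "epsh \<le> eps" "eps \<le> epsl"
    and m_plus_defined: "(real m + 1) * epsh < 1"
    and tau_less_1: "tau A eps < 1"
    and rho_less_1: "\<rho> < 1"
    and solver_total: "\<forall>r. \<exists>y. solver r y"
    and solver_bound: "\<forall>r y. solver r y \<longrightarrow>
           energy_norm A (y - matrix_inv A *v r) \<le> \<rho> * energy_norm A (matrix_inv A *v r)"
  shows "(\<forall>x x'. ir_cycle A b m eps epsh solver x x' \<longrightarrow>
             rel_err A b x' \<le> (\<rho> + delta_rho_ir A m eps epsh \<rho>) * rel_err A b x
                               + chi_ir A m eps epsh \<rho>) \<and>
         (\<rho> + delta_rho_ir A m eps epsh \<rho> < 1 \<longrightarrow>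
           (\<forall>(x :: nat \<Rightarrow> real ^ 'n) N. N \<ge> 1 \<longrightarrow>
             (\<forall>i<N. ir_cycle A b m eps epsh solver (x i) (x (Suc i))) \<longrightarrow>
             rel_err A b (x N) \<le> (\<rho> + delta_rho_ir A m eps epsh \<rho>) ^ N * rel_err A b (x 0)
               + chi_ir A m eps epsh \<rho> / (1 - (\<rho> + delta_rho_ir A m eps epsh \<rho>))))"
proof -
  define q where "q = \<rho> + delta_rho_ir A m eps epsh \<rho>"
  define d where "d = chi_ir A m eps epsh \<rho>"
  have eps: "0 \<le> eps" using precisions by simp
  have rho: "0 \<le> \<rho>" using convergence_factor_nonneg[OF spd solver_total] solver_bound by blast
  have q: "0 \<le> q" and d: "0 \<le> d"
    using ir_constants_nonneg[OF spd eps precisions(1) m_plus_defined tau_less_1 rho] rho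
    by (simp_all add: q_def d_def)
  have step: "rel_err A b x' \<le> q * rel_err A b x + d"
    if "ir_cycle A b m eps epsh solver x x'" for x x'
  proof (cases "energy_norm A (matrix_inv A *v b) = 0")
    case True
    \<comment> \<open>Both relative errors are divisions by zero, hence zero.\<close>
    then show ?thesis using d by (simp add: rel_err_def)
  next
    case False
    then have "0 < energy_norm A (matrix_inv A *v b)"
      using energy_norm_nonneg[of A "matrix_inv A *v b"] by simp
    then show ?thesis
      using ir_cycle_energy_bound[OF spd eps precisions(1) m_plus_defined tau_less_1 rho
          solver_bound[rule_format] that]
      by (simp add: rel_err_def q_def[symmetric] d_def[symmetric] field_simps)
  qed
  have "rel_err A b (x N) \<le> q ^ N * rel_err A b (x 0) + d / (1 - q)"
    if "q < 1" "\<forall>i<N. ir_cycle A b m eps epsh solver (x i) (x (Suc i))" for x N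
    using affine_recursion_bound[of q d N "\<lambda>i. rel_err A b (x i)"] q d that step by blast
  then show ?thesis using step by (auto simp: q_def d_def)
qed

end
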